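(* There exists an absolute constant $C$ such that the following holds. Let $N\ge3$, let $f:\mathbb{Z}_N\to\mathbb{C}$ be nonzero, and for $\eta>0$ define the large spectrum set $$\Gamma=\left\{m\in\mathbb{Z}_N : |\widehat f(m)|\ge\eta\,\|f\|_{L^2(\mu)}\right\}.$$ Then there exists some $\Lambda\subset\Gamma$ such that every $m\in\Gamma$ is a $\{-1,0,1\}$-linear combination of elements of $\Lambda$, and moreover $$|\Lambda|\le C\eta^{-2}\left(\frac{\|f\|_{\frac{\log N}{\log N-1}}}{\|f\|_2}\right)^2\log N .$$ If, additionally, $\frac{\|f\|_1}{\|f\|_2}\le\frac1e\sqrt N$, then we have $$|\Lambda|\le C\eta^{-2}\,\frac{\|f\|_1^2}{\|f\|_2^2}\,\log\left(\left(\frac{\|f\|_2}{\|f\|_1}\right)^2N\right).$$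
   Context: $\mathbb{Z}_N=\mathbb{Z}/N\mathbb{Z}$. For $f:\mathbb{Z}_N\to\mathbb{C}$ the unitary Fourier transform is $\widehat f(m)=N^{-1/2}\sum_{x\in\mathbb{Z}_N}e^{-2\pi i xm/N}f(x)$. For $1\le p<\infty$, $\|g\|_p=\left(\sum_{x\in\mathbb{Z}_N}|g(x)|^p\right)^{1/p}$, and $\|g\|_{L^2(\mu)}=N^{-1/2}\|g\|_2$. $\log$ is the natural logarithm. A $\{-1,0,1\}$-linear combination of elements of $\Lambda$ is a sum $\sum_{\lambda\in\Lambda}\epsilon_\lambda\lambda$ in $\mathbb{Z}_N$ with each $\epsilon_\lambda\in\{-1,0,1\}$. *)

theory Defs
  imports Complex_Main "HOL-Number_Theory.Cong"
begin

text \<open>The group of integers modulo \<open>N\<close> is represented by the least residues; a function on it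
  is a function on \<open>int\<close> of which only the values on these residues are ever used. Addition in
  the group is addition of integers up to congruence modulo \<open>N\<close>.\<close>

definition ZN :: "nat \<Rightarrow> int set" where
  "ZN N = {0..<int N}"

definition fourier :: "nat \<Rightarrow> (int \<Rightarrow> complex) \<Rightarrow> int \<Rightarrow> complex" where
  "fourier N f m =
     (\<Sum>x\<in>ZN N. exp (- 2 * of_real pi * \<i> * of_int x * of_int m / of_nat N) * f x)
       / of_real (sqrt (real N))"

definition lp_norm :: "nat \<Rightarrow> real \<Rightarrow> (int \<Rightarrow> complex) \<Rightarrow> real" where
  "lp_norm N p g = (\<Sum>x\<in>ZN N. cmod (g x) powr p) powr (1 / p)"

definition L2mu_norm :: "nat \<Rightarrow> (int \<Rightarrow> complex) \<Rightarrow> real" where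
  "L2mu_norm N g = lp_norm N 2 g / sqrt (real N)"

definition large_spectrum :: "nat \<Rightarrow> (int \<Rightarrow> complex) \<Rightarrow> real \<Rightarrow> int set" where
  "large_spectrum N f \<eta> = {m \<in> ZN N. cmod (fourier N f m) \<ge> \<eta> * L2mu_norm N f}"

definition signed_combination :: "nat \<Rightarrow> int set \<Rightarrow> int \<Rightarrow> bool" where
  "signed_combination N \<Lambda> m \<longleftrightarrow>
     (\<exists>\<epsilon> :: int \<Rightarrow> int. (\<forall>l\<in>\<Lambda>. \<epsilon> l \<in> {-1, 0, 1}) \<and> [(\<Sum>l\<in>\<Lambda>. \<epsilon> l * l) = m] (mod int N))"

end

theory Submission
  imports Defs "HOL-Library.FuncSet" "HOL-Analysis.Convex"
begin

text \<open>Take \<open>\<Lambda>\<close> maximal among the dissociated subsets of the large spectrum. Maximality makes every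
  element of the spectrum a signed combination of \<open>\<Lambda>\<close>. For the size, expanding a Riesz product
  shows that a trigonometric polynomial \<open>T\<close> with frequencies in \<open>\<Lambda>\<close> has Gaussian exponential
  moments, hence (Rudin) \<open>L\<^sup>p(\<mu>)\<close> norm at most of order \<open>sqrt p\<close> times the \<open>\<ell>\<^sup>2\<close> norm of its
  coefficients. Testing this against \<open>f\<close> by Hoelder's inequality bounds \<open>|\<Lambda>|\<close> by
  \<open>16 p N\<^bsup>2/p\<^esup> \<eta>\<^bsup>-2\<^esup> (\<parallel>f\<parallel>\<^sub>q / \<parallel>f\<parallel>\<^sub>2)\<^sup>2\<close> with \<open>q\<close> conjugate to \<open>p\<close>. The first
  estimate is \<open>p = log N\<close>. For the second, interpolate \<open>\<parallel>f\<parallel>\<^sub>q\<close> between \<open>\<parallel>f\<parallel>\<^sub>1\<close> and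
  \<open>\<parallel>f\<parallel>\<^sub>2\<close> and take \<open>p = log ((\<parallel>f\<parallel>\<^sub>2 / \<parallel>f\<parallel>\<^sub>1)\<^sup>2 N)\<close>.\<close>

section \<open>Dissociated sets\<close>

definition dissociated :: "nat \<Rightarrow> int set \<Rightarrow> bool" where
  "dissociated N \<Lambda> \<longleftrightarrow>
     (\<forall>\<epsilon> :: int \<Rightarrow> int. (\<forall>l\<in>\<Lambda>. \<epsilon> l \<in> {-1, 0, 1}) \<longrightarrow> [(\<Sum>l\<in>\<Lambda>. \<epsilon> l * l) = 0] (mod int N)
        \<longrightarrow> (\<forall>l\<in>\<Lambda>. \<epsilon> l = 0))"

lemma signed_combination_member:
  assumes "finite \<Lambda>" "m \<in> \<Lambda>"
  shows "signed_combination N \<Lambda> m"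
  unfolding signed_combination_def
proof (intro exI conjI)
  show "\<forall>l\<in>\<Lambda>. (if l = m then 1 else 0 :: int) \<in> {-1, 0, 1}" by auto
  have "(\<Sum>l\<in>\<Lambda>. (if l = m then 1 else 0) * l) = (\<Sum>l\<in>\<Lambda>. if l = m then l else 0)"
    by (intro sum.cong) auto
  also have "\<dots> = m" using assms by simp
  finally show "[(\<Sum>l\<in>\<Lambda>. (if l = m then 1 else 0) * l) = m] (mod int N)" by simp
qed

text \<open>A nontrivial relation on \<open>insert m \<Lambda>\<close> must involve
  \<open>m\<close>, since \<open>\<Lambda>\<close> alone admits none. The coefficient of
  \<open>m\<close> is then 1 or -1, so the relation can be solved for \<open>m\<close> without
  division, at most after flipping all signs.\<close>

lemma signed_combination_if_not_dissociated_insert: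
  assumes "finite \<Lambda>" "dissociated N \<Lambda>" "\<not> dissociated N (insert m \<Lambda>)"
  shows "signed_combination N \<Lambda> m"
proof (cases "m \<in> \<Lambda>")
  case True
  with assms(1) show ?thesis by (rule signed_combination_member)
next
  case False
  obtain \<epsilon> where \<epsilon>: "\<forall>l\<in>insert m \<Lambda>. \<epsilon> l \<in> {-1, 0, 1}"
      "[(\<Sum>l\<in>insert m \<Lambda>. \<epsilon> l * l) = 0] (mod int N)" "\<exists>l\<in>insert m \<Lambda>. \<epsilon> l \<noteq> 0"
    using assms(3) unfolding dissociated_def by blast
  have sum: "[\<epsilon> m * m + (\<Sum>l\<in>\<Lambda>. \<epsilon> l * l) = 0] (mod int N)"
    using \<epsilon>(2) False assms(1) by simp
  have "\<epsilon> m \<noteq> 0"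
  proof
    assume "\<epsilon> m = 0"
    with sum have "\<forall>l\<in>\<Lambda>. \<epsilon> l = 0"
      using assms(2) \<epsilon>(1) unfolding dissociated_def by simp
    with \<open>\<epsilon> m = 0\<close> \<epsilon>(3) show False by auto
  qed
  then consider "\<epsilon> m = 1" | "\<epsilon> m = -1" using \<epsilon>(1) by auto
  then show ?thesis
  proof cases
    case 1
    have "int N dvd m + (\<Sum>l\<in>\<Lambda>. \<epsilon> l * l)" using sum 1 by (simp add: cong_0_iff)
    then have "int N dvd - (m + (\<Sum>l\<in>\<Lambda>. \<epsilon> l * l))" by (simp only: dvd_minus_iff)
    also have "- (m + (\<Sum>l\<in>\<Lambda>. \<epsilon> l * l)) = (\<Sum>l\<in>\<Lambda>. - \<epsilon> l * l) - m"
      by (simp add: sum_negf)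
    finally have "[(\<Sum>l\<in>\<Lambda>. - \<epsilon> l * l) = m] (mod int N)"
      by (simp only: cong_iff_dvd_diff)
    then show ?thesis
      using \<epsilon>(1) unfolding signed_combination_def by (intro exI[of _ "\<lambda>l. - \<epsilon> l"]) auto
  next
    case 2
    have "[(\<Sum>l\<in>\<Lambda>. \<epsilon> l * l) = m] (mod int N)"
      using sum 2 by (simp add: cong_iff_dvd_diff)
    then show ?thesis
      using \<epsilon>(1) unfolding signed_combination_def by auto
  qed
qed

text \<open>The empty set is dissociated and \<open>\<Gamma>\<close> has finitely many subsets, so a
  dissociated subset maximal under inclusion exists; adjoining any further element of
  \<open>\<Gamma>\<close> destroys dissociativity.\<close>

lemma exists_dissociated_spanning_subset:
  assumes "finite \<Gamma>"
  shows "\<exists>\<Lambda>\<subseteq>\<Gamma>. dissociated N \<Lambda> \<and> (\<forall>m\<in>\<Gamma>. signed_combination N \<Lambda> m)"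
proof -
  have "finite {\<Lambda>. \<Lambda> \<subseteq> \<Gamma> \<and> dissociated N \<Lambda>}" using assms by simp
  moreover have "{} \<in> {\<Lambda>. \<Lambda> \<subseteq> \<Gamma> \<and> dissociated N \<Lambda>}" by (simp add: dissociated_def)
  ultimately obtain \<Lambda> where \<Lambda>: "\<Lambda> \<subseteq> \<Gamma>" "dissociated N \<Lambda>"
    and max: "\<And>\<Lambda>'. \<Lambda>' \<subseteq> \<Gamma> \<Longrightarrow> dissociated N \<Lambda>' \<Longrightarrow> \<Lambda> \<subseteq> \<Lambda>' \<Longrightarrow> \<Lambda>' = \<Lambda>"
    by (smt (verit) finite_has_maximal2 mem_Collect_eq)
  have fin: "finite \<Lambda>" using \<Lambda>(1) assms by (rule finite_subset)
  have "signed_combination N \<Lambda> m" if "m \<in> \<Gamma>" for m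
  proof (cases "m \<in> \<Lambda>")
    case True
    with fin show ?thesis by (rule signed_combination_member)
  next
    case False
    then have "\<not> dissociated N (insert m \<Lambda>)" using max[of "insert m \<Lambda>"] \<Lambda>(1) that by auto
    then show ?thesis
      by (rule signed_combination_if_not_dissociated_insert[OF fin \<Lambda>(2)])
  qed
  then show ?thesis using \<Lambda> by blast
qed

section \<open>Characters and Riesz products\<close>

text \<open>The kernel of \<open>fourier\<close>, with its sign, as a function of the product of
  point and frequency, so that additivity in \<open>k\<close> serves both variables.\<close>

definition char_exp :: "nat \<Rightarrow> int \<Rightarrow> complex" where
  "char_exp N k = exp (- 2 * of_real pi * \<i> * of_int k / of_nat N)"

lemma char_exp_add: "char_exp N (j + k) = char_exp N j * char_exp N k"
  unfolding char_exp_def exp_add[symmetric]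
  by (simp add: add_divide_distrib diff_divide_distrib ring_distribs)

lemma char_exp_sum: "char_exp N (sum g A) = (\<Prod>a\<in>A. char_exp N (g a))"
proof (induction A rule: infinite_finite_induct)
  case (insert a A)
  then show ?case by (simp add: char_exp_add)
qed (simp_all add: char_exp_def)

lemma char_exp_mult_nat: "char_exp N (int n * k) = char_exp N k ^ n"
proof (induction n)
  case (Suc n)
  have "char_exp N (int (Suc n) * k) = char_exp N (k + int n * k)" by (simp add: ring_distribs)
  with Suc show ?case by (simp add: char_exp_add)
qed (simp add: char_exp_def)

lemma char_exp_eq_cis: "char_exp N k = cis (- 2 * pi * of_int k / real N)"
  unfolding char_exp_def cis_conv_exp by (simp add: mult_ac)

lemma cnj_char_exp: "cnj (char_exp N k) = char_exp N (- k)"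
  by (simp add: char_exp_eq_cis cis_cnj)

lemma cmod_char_exp: "cmod (char_exp N k) = 1"
  by (simp add: char_exp_eq_cis)

lemma char_exp_eq_1_imp_cong:
  assumes "N > 0" "char_exp N k = 1"
  shows "[k = 0] (mod int N)"
proof -
  have "cos (- 2 * pi * of_int k / real N) = 1"
    using arg_cong[OF assms(2), of Re] by (simp add: char_exp_eq_cis)
  then obtain n :: int where "- 2 * pi * of_int k / real N = of_int n * 2 * pi"
    unfolding cos_one_2pi_int by blast
  then have "pi * (- real_of_int k) = pi * (of_int n * real N)"
    using assms(1) by (simp add: field_simps)
  then have "- real_of_int k = of_int n * real N"
    by (simp only: mult_cancel_left pi_neq_zero simp_thms)
  then have "real_of_int k = real_of_int (int N * (- n))" by (simp add: mult.commute)
  then have "k = int N * (- n)" by (simp only: of_int_eq_iff)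
  then show ?thesis by (simp add: cong_0_iff)
qed

lemma finite_ZN [simp]: "finite (ZN N)"
  by (simp add: ZN_def)

lemma card_ZN [simp]: "card (ZN N) = N"
  by (simp add: ZN_def)

text \<open>A geometric sum over a full period whose ratio is an \<open>N\<close>-th root of unity
  other than 1.\<close>

lemma sum_char_exp_eq_0:
  assumes "N > 0" "\<not> [k = 0] (mod int N)"
  shows "(\<Sum>x\<in>ZN N. char_exp N (x * k)) = 0"
proof -
  let ?z = "char_exp N k"
  have "?z \<noteq> 1" using assms char_exp_eq_1_imp_cong by blast
  have "?z ^ N = char_exp N (int N * k)" by (simp add: char_exp_mult_nat)
  also have "\<dots> = cis (2 * pi * of_int (- k))"
    using assms(1) by (simp add: char_exp_eq_cis mult_ac)
  also have "\<dots> = 1" by (rule cis_multiple_2pi) simp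
  finally have "?z ^ N = 1" .
  have "ZN N = int ` {..<N}"
    unfolding ZN_def by (simp add: image_int_atLeastLessThan lessThan_atLeast0)
  then have "(\<Sum>x\<in>ZN N. char_exp N (x * k)) = (\<Sum>n<N. ?z ^ n)"
    by (simp add: sum.reindex char_exp_mult_nat)
  also have "\<dots> = 0" using \<open>?z \<noteq> 1\<close> \<open>?z ^ N = 1\<close> by (simp add: geometric_sum)
  finally show ?thesis .
qed

text \<open>Each factor has frequencies \<open>-l\<close>, 0 and \<open>l\<close> only, so the
  product expands into characters with frequencies
  \<open>\<Sum>l\<in>\<Lambda>. \<epsilon> l * l\<close>. By dissociativity such a frequency
  vanishes modulo \<open>N\<close> only for \<open>\<epsilon> = 0\<close>, and orthogonality removes
  every other term.\<close>

lemma sum_riesz_product: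
  fixes a b :: "int \<Rightarrow> real" and c :: "int \<Rightarrow> complex"
  assumes "N > 0" "finite \<Lambda>" "dissociated N \<Lambda>"
  shows "(\<Sum>x\<in>ZN N. \<Prod>l\<in>\<Lambda>. a l + b l * Re (c l * char_exp N (x * l))) = real N * (\<Prod>l\<in>\<Lambda>. a l)"
proof -
  \<comment> \<open>The coefficient of the character with frequency \<open>s * l\<close> in the
    factor of \<open>l\<close>, read off from \<open>Re w = (w + cnj w) / 2\<close>.\<close>
  define coef :: "int \<Rightarrow> int \<Rightarrow> complex" where
    "coef l s = (if s = 0 then of_real (a l)
       else if s = 1 then of_real (b l) * c l / 2 else of_real (b l) * cnj (c l) / 2)" for l s
  let ?P = "\<Lambda> \<rightarrow>\<^sub>E {-1, 0, 1::int}"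
  \<comment> \<open>The zero choice of signs has to be extensional, that is \<open>undefined\<close>
    off \<open>\<Lambda>\<close>, to be a member of \<open>?P\<close>.\<close>
  let ?z = "\<lambda>l\<in>\<Lambda>. 0::int"
  have fac: "complex_of_real (a l + b l * Re (c l * char_exp N (x * l)))
      = (\<Sum>s\<in>{-1, 0, 1}. coef l s * char_exp N (x * (s * l)))" for x l
  proof -
    have "complex_of_real (Re w) = (w + cnj w) / 2" for w
      by (simp add: complex_add_cnj)
    then have re: "complex_of_real (Re (c l * char_exp N (x * l)))
        = (c l * char_exp N (x * l) + cnj (c l) * char_exp N (- (x * l))) / 2"
      by (simp only: complex_cnj_mult cnj_char_exp)
    have "char_exp N 0 = 1" by (simp add: char_exp_def)
    then show ?thesis
      unfolding of_real_add of_real_mult re by (simp add: coef_def field_simps)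
  qed
  have "complex_of_real (\<Sum>x\<in>ZN N. \<Prod>l\<in>\<Lambda>. a l + b l * Re (c l * char_exp N (x * l)))
      = (\<Sum>x\<in>ZN N. \<Prod>l\<in>\<Lambda>. \<Sum>s\<in>{-1, 0, 1}. coef l s * char_exp N (x * (s * l)))"
    by (simp only: of_real_sum of_real_prod fac)
  also have "\<dots> = (\<Sum>x\<in>ZN N. \<Sum>\<epsilon>\<in>?P. \<Prod>l\<in>\<Lambda>. coef l (\<epsilon> l) * char_exp N (x * (\<epsilon> l * l)))"
    using assms(2) by (simp only: prod_sum_PiE finite.intros)
  also have "\<dots> = (\<Sum>\<epsilon>\<in>?P. \<Sum>x\<in>ZN N. \<Prod>l\<in>\<Lambda>. coef l (\<epsilon> l) * char_exp N (x * (\<epsilon> l * l)))"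
    by (rule sum.swap)
  also have "\<dots> = (\<Sum>\<epsilon>\<in>?P. (\<Prod>l\<in>\<Lambda>. coef l (\<epsilon> l)) *
      (\<Sum>x\<in>ZN N. char_exp N (x * (\<Sum>l\<in>\<Lambda>. \<epsilon> l * l))))"
    by (simp add: prod.distrib sum_distrib_left char_exp_sum)
  also have "\<dots> = (\<Sum>\<epsilon>\<in>?P. if \<epsilon> = ?z then (\<Prod>l\<in>\<Lambda>. of_real (a l)) * of_nat N else 0)"
  proof (rule sum.cong[OF refl])
    fix \<epsilon> assume \<epsilon>: "\<epsilon> \<in> ?P"
    show "(\<Prod>l\<in>\<Lambda>. coef l (\<epsilon> l)) * (\<Sum>x\<in>ZN N. char_exp N (x * (\<Sum>l\<in>\<Lambda>. \<epsilon> l * l)))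
        = (if \<epsilon> = ?z then (\<Prod>l\<in>\<Lambda>. of_real (a l)) * of_nat N else 0)"
    proof (cases "\<epsilon> = ?z")
      case True
      then show ?thesis by (simp add: coef_def char_exp_def)
    next
      case False
      have "\<exists>l\<in>\<Lambda>. \<epsilon> l \<noteq> 0"
      proof (rule ccontr)
        assume "\<not> (\<exists>l\<in>\<Lambda>. \<epsilon> l \<noteq> 0)"
        then have "\<epsilon> = ?z" using \<epsilon> by (intro ext) (auto simp: PiE_def extensional_def)
        with False show False by simp
      qed
      moreover have "\<forall>l\<in>\<Lambda>. \<epsilon> l \<in> {-1, 0, 1}" using \<epsilon> by (auto simp: PiE_def Pi_def)
      ultimately have "\<not> [(\<Sum>l\<in>\<Lambda>. \<epsilon> l * l) = 0] (mod int N)"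
        using assms(3) unfolding dissociated_def by blast
      then show ?thesis using False sum_char_exp_eq_0[OF assms(1)] by simp
    qed
  qed
  also have "\<dots> = (\<Prod>l\<in>\<Lambda>. of_real (a l)) * of_nat N"
  proof -
    have "finite ?P" using assms(2) by (intro finite_PiE) auto
    moreover have "?z \<in> ?P" by auto
    ultimately show ?thesis by simp
  qed
  also have "\<dots> = complex_of_real (real N * (\<Prod>l\<in>\<Lambda>. a l))" by (simp add: mult.commute)
  finally show ?thesis by (simp only: of_real_eq_iff)
qed

section \<open>Gaussian exponential moments\<close>

lemma cosh_le_exp_square: "cosh u \<le> exp (u\<^sup>2)" for u :: real
proof -
  have *: "cosh u \<le> exp (u\<^sup>2)" if "u \<ge> 0" for u :: real
  proof (cases "u \<le> 1")
    case True
    have 1: "exp u \<le> 1 + u + u\<^sup>2" using that True by (rule exp_bound)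
    \<comment> \<open>The right side equals \<open>1 + u^3\<close>. Combined with
      \<open>1 + u \<le> exp u\<close> it bounds the reciprocal \<open>exp (- u)\<close>.\<close>
    have "1 \<le> (1 - u + u\<^sup>2) * (1 + u)"
      using that by (simp add: algebra_simps power2_eq_square)
    also have "\<dots> \<le> (1 - u + u\<^sup>2) * exp u"
    proof (rule mult_left_mono)
      show "0 \<le> 1 - u + u\<^sup>2" using True by simp
    qed simp
    finally have "exp (- u) \<le> 1 - u + u\<^sup>2" by (simp add: exp_minus field_simps)
    with 1 have "cosh u \<le> 1 + u\<^sup>2" by (simp add: cosh_def)
    also have "\<dots> \<le> exp (u\<^sup>2)" by simp
    finally show ?thesis .
  next
    case False
    then have "u \<le> u\<^sup>2" by (simp add: power2_eq_square)
    then have "exp u \<le> exp (u\<^sup>2)" by simp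
    moreover have "exp (- u) \<le> exp u" using that by simp
    ultimately have "exp u + exp (- u) \<le> 2 * exp (u\<^sup>2)" by linarith
    then show ?thesis by (simp add: cosh_def)
  qed
  show ?thesis using *[of u] *[of "- u"] by (cases "u \<ge> 0") simp_all
qed

text \<open>The chord of \<open>exp\<close> over \<open>[-r, r]\<close>; for \<open>r = 0\<close> the quotient is the junk value \<open>0\<close>.\<close>

lemma exp_le_chord:
  fixes r y :: real
  assumes "\<bar>y\<bar> \<le> r"
  shows "exp y \<le> cosh r + sinh r / r * y"
proof (cases "r = 0")
  case False
  then have r: "r > 0" using assms by linarith
  define t where "t = (1 + y / r) / 2"
  have t: "0 \<le> t" "t \<le> 1" using assms r by (auto simp: t_def field_simps abs_le_iff)
  have "exp ((1 - t) *\<^sub>R (- r) + t *\<^sub>R r) \<le> (1 - t) * exp (- r) + t * exp r"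
    using exp_convex t by (intro convex_onD) auto
  also have "(1 - t) *\<^sub>R (- r) + t *\<^sub>R r = y" using r by (simp add: t_def field_simps)
  also have "(1 - t) * exp (- r) + t * exp r = cosh r + sinh r / r * y"
    using r by (simp add: t_def cosh_def sinh_def field_simps)
  finally show ?thesis .
qed (use assms in simp)

text \<open>The exponential of the sum is a product. Replacing each factor by its chord over
  \<open>[-r, r]\<close>, where \<open>r = cmod (c l)\<close>, gives a Riesz product, whose mean is
  the product of the constant terms \<open>cosh r\<close>.\<close>

lemma sum_exp_Re_dissociated_le:
  fixes c :: "int \<Rightarrow> complex"
  assumes "N > 0" "finite \<Lambda>" "dissociated N \<Lambda>"
  shows "(\<Sum>x\<in>ZN N. exp (Re (\<Sum>l\<in>\<Lambda>. c l * char_exp N (x * l))))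
           \<le> real N * exp (\<Sum>l\<in>\<Lambda>. (cmod (c l))\<^sup>2)"
proof -
  let ?r = "\<lambda>l. cmod (c l)"
  have "(\<Sum>x\<in>ZN N. exp (Re (\<Sum>l\<in>\<Lambda>. c l * char_exp N (x * l))))
      = (\<Sum>x\<in>ZN N. \<Prod>l\<in>\<Lambda>. exp (Re (c l * char_exp N (x * l))))"
    by (simp only: Re_sum exp_sum[OF assms(2)])
  also have "\<dots> \<le> (\<Sum>x\<in>ZN N. \<Prod>l\<in>\<Lambda>.
      cosh (?r l) + sinh (?r l) / ?r l * Re (c l * char_exp N (x * l)))"
  proof (intro sum_mono prod_mono conjI exp_le_chord)
    fix x l
    show "\<bar>Re (c l * char_exp N (x * l))\<bar> \<le> ?r l"
      using abs_Re_le_cmod[of "c l * char_exp N (x * l)"]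
      by (simp only: norm_mult cmod_char_exp mult_1_right)
  qed simp
  also have "\<dots> = real N * (\<Prod>l\<in>\<Lambda>. cosh (?r l))"
    by (rule sum_riesz_product[OF assms])
  also have "\<dots> \<le> real N * (\<Prod>l\<in>\<Lambda>. exp ((?r l)\<^sup>2))"
    by (intro mult_left_mono prod_mono conjI cosh_le_exp_square) simp_all
  also have "\<dots> = real N * exp (\<Sum>l\<in>\<Lambda>. (?r l)\<^sup>2)"
    by (simp add: exp_sum[OF assms(2)])
  finally show ?thesis .
qed

section \<open>Rudin's inequality\<close>

text \<open>The factor \<open>(p / exp 1) powr p\<close> is the maximum of
  \<open>y powr p * exp (- y)\<close>, attained at \<open>y = p\<close>.\<close>

lemma powr_le_exp:
  fixes y p :: real
  assumes "y \<ge> 0" "p > 0"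
  shows "y powr p \<le> (p / exp 1) powr p * exp y"
proof (cases "y = 0")
  case False
  then have y: "y > 0" using assms by simp
  have "ln (y / p) \<le> y / p - 1" using y assms(2) by (intro ln_le_minus_one) simp
  then have "p * ln (y / p) \<le> p * (y / p - 1)" using assms(2) by (intro mult_left_mono) auto
  then have "p * ln y \<le> p * (ln p - 1) + y"
    using y assms(2) by (simp add: ln_div algebra_simps)
  then have "exp (p * ln y) \<le> exp (p * (ln p - 1) + y)" by simp
  then show ?thesis using y assms(2) by (simp add: powr_def ln_div exp_add)
qed simp

text \<open>The \<open>p\<close>-th power of \<open>t * \<bar>T x\<bar>\<close> is dominated by
  exponentials of \<open>t * T x\<close> and \<open>- t * T x\<close>, whose moments are Gaussian.
  The choice \<open>t\<^sup>2 * S = p\<close> makes the moment bound \<open>exp p\<close> cancel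
  against \<open>(p / exp 1) powr p\<close>, and \<open>p / t\<close> is the claimed
  \<open>sqrt p * sqrt S\<close>.\<close>

lemma rudin_Re:
  fixes c :: "int \<Rightarrow> complex" and p :: real
  assumes "N > 0" "finite \<Lambda>" "dissociated N \<Lambda>" "p \<ge> 1"
  shows "(\<Sum>x\<in>ZN N. \<bar>Re (\<Sum>l\<in>\<Lambda>. c l * char_exp N (x * l))\<bar> powr p) powr (1 / p)
           \<le> 2 * real N powr (1 / p) * sqrt p * sqrt (\<Sum>l\<in>\<Lambda>. (cmod (c l))\<^sup>2)"
proof (cases "(\<Sum>l\<in>\<Lambda>. (cmod (c l))\<^sup>2) = 0")
  \<comment> \<open>Split off because \<open>t\<close> below divides by \<open>sqrt S\<close>; here
    all coefficients vanish.\<close>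
  case True
  then have "c l = 0" if "l \<in> \<Lambda>" for l using that assms(2) by (simp add: sum_nonneg_eq_0_iff)
  then show ?thesis by simp
next
  case False
  define S where "S = (\<Sum>l\<in>\<Lambda>. (cmod (c l))\<^sup>2)"
  define T where "T x = Re (\<Sum>l\<in>\<Lambda>. c l * char_exp N (x * l))" for x
  define t where "t = sqrt p / sqrt S"
  have S: "S > 0" using False unfolding S_def by (simp add: order_less_le sum_nonneg)
  have t: "t > 0" using S assms(4) by (simp add: t_def)
  have t2: "t\<^sup>2 * S = p" using S assms(4) by (simp add: t_def power_divide)
  \<comment> \<open>Stated for \<open>s\<close> so that it covers both \<open>t\<close> and
    \<open>- t\<close>.\<close>
  have moment: "(\<Sum>x\<in>ZN N. exp (s * T x)) \<le> real N * exp p" if "s\<^sup>2 = t\<^sup>2" for s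
  proof -
    have "s * T x = Re (\<Sum>l\<in>\<Lambda>. (of_real s * c l) * char_exp N (x * l))" for x
      unfolding T_def mult.assoc sum_distrib_left[symmetric] by simp
    moreover have "(\<Sum>l\<in>\<Lambda>. (cmod (of_real s * c l))\<^sup>2) = p"
      using t2 that unfolding S_def
      by (simp add: norm_mult power_mult_distrib sum_distrib_left)
    ultimately show ?thesis
      using sum_exp_Re_dissociated_le[OF assms(1-3), of "\<lambda>l. of_real s * c l"] by simp
  qed
  have "t powr p * (\<Sum>x\<in>ZN N. \<bar>T x\<bar> powr p) = (\<Sum>x\<in>ZN N. (t * \<bar>T x\<bar>) powr p)"
    using t by (simp add: sum_distrib_left powr_mult)
  also have "\<dots> \<le> (\<Sum>x\<in>ZN N. (p / exp 1) powr p * (exp (t * T x) + exp (- t * T x)))"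
  proof (rule sum_mono)
    fix x
    have "(t * \<bar>T x\<bar>) powr p \<le> (p / exp 1) powr p * exp (t * \<bar>T x\<bar>)"
      using t assms(4) by (intro powr_le_exp) auto
    also have "exp (t * \<bar>T x\<bar>) \<le> exp (t * T x) + exp (- t * T x)"
      by (cases "T x \<ge> 0") auto
    finally show "(t * \<bar>T x\<bar>) powr p \<le> (p / exp 1) powr p * (exp (t * T x) + exp (- t * T x))"
      by (simp add: mult_left_mono)
  qed
  also have "\<dots> = (p / exp 1) powr p *
      ((\<Sum>x\<in>ZN N. exp (t * T x)) + (\<Sum>x\<in>ZN N. exp (- t * T x)))"
    by (simp only: sum_distrib_left[symmetric] sum.distrib)
  also have "\<dots> \<le> (p / exp 1) powr p * (real N * exp p + real N * exp p)"
    by (intro mult_left_mono add_mono moment) simp_all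
  also have "\<dots> = 2 * real N * p powr p"
    using assms(4) by (simp add: powr_divide powr_def[of "exp 1"])
  finally have "t powr p * (\<Sum>x\<in>ZN N. \<bar>T x\<bar> powr p) \<le> 2 * real N * p powr p" .
  then have "(t powr p * (\<Sum>x\<in>ZN N. \<bar>T x\<bar> powr p)) powr (1 / p)
      \<le> (2 * real N * p powr p) powr (1 / p)"
    using assms(4) by (intro powr_mono2) (auto intro!: mult_nonneg_nonneg sum_nonneg)
  then have "t * (\<Sum>x\<in>ZN N. \<bar>T x\<bar> powr p) powr (1 / p)
      \<le> 2 powr (1 / p) * real N powr (1 / p) * p"
    using t assms(4) by (simp add: powr_mult powr_powr sum_nonneg)
  also have "\<dots> \<le> 2 * real N powr (1 / p) * p"
  proof -
    have "(2::real) powr (1 / p) \<le> 2 powr 1" using assms(4) by (intro powr_mono) auto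
    then show ?thesis using assms(4) by (intro mult_right_mono) auto
  qed
  finally have "(\<Sum>x\<in>ZN N. \<bar>T x\<bar> powr p) powr (1 / p) \<le> 2 * real N powr (1 / p) * (p / t)"
    using t by (simp add: field_simps)
  also have "p / t = sqrt p * sqrt S"
    using S assms(4) by (simp add: t_def field_simps)
  finally show ?thesis unfolding T_def S_def by (simp add: mult.assoc)
qed

text \<open>\<open>Im w = Re (- \<i> * w)\<close>, and multiplying the coefficients by
  \<open>- \<i>\<close> keeps their moduli.\<close>

lemma rudin_Im:
  fixes c :: "int \<Rightarrow> complex" and p :: real
  assumes "N > 0" "finite \<Lambda>" "dissociated N \<Lambda>" "p \<ge> 1"
  shows "(\<Sum>x\<in>ZN N. \<bar>Im (\<Sum>l\<in>\<Lambda>. c l * char_exp N (x * l))\<bar> powr p) powr (1 / p)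
           \<le> 2 * real N powr (1 / p) * sqrt p * sqrt (\<Sum>l\<in>\<Lambda>. (cmod (c l))\<^sup>2)"
proof -
  have "Im (\<Sum>l\<in>\<Lambda>. c l * char_exp N (x * l)) = Re (\<Sum>l\<in>\<Lambda>. (- \<i> * c l) * char_exp N (x * l))" for x
    by (simp add: algebra_simps)
  then show ?thesis
    using rudin_Re[OF assms, of "\<lambda>l. - \<i> * c l"] by (simp add: norm_mult)
qed

section \<open>Norm inequalities\<close>

text \<open>Young's inequality is summed over the functions scaled to norm 1; if either norm is 0,
  every product vanishes.\<close>

lemma holder_inequality_sum:
  fixes u v :: "'a \<Rightarrow> real" and p q :: real
  assumes "finite A" "p > 1" "q > 1" "1 / p + 1 / q = 1"
    and nonneg: "\<And>x. x \<in> A \<Longrightarrow> u x \<ge> 0" "\<And>x. x \<in> A \<Longrightarrow> v x \<ge> 0"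
  shows "(\<Sum>x\<in>A. u x * v x) \<le> (\<Sum>x\<in>A. u x powr p) powr (1 / p) * (\<Sum>x\<in>A. v x powr q) powr (1 / q)"
proof -
  define U V where "U = (\<Sum>x\<in>A. u x powr p)" and "V = (\<Sum>x\<in>A. v x powr q)"
  have UV: "U \<ge> 0" "V \<ge> 0" by (auto simp: U_def V_def sum_nonneg)
  show ?thesis
  proof (cases "U = 0 \<or> V = 0")
    case True
    then have "u x * v x = 0" if "x \<in> A" for x
      using that assms(1) unfolding U_def V_def by (auto simp: sum_nonneg_eq_0_iff)
    then have "(\<Sum>x\<in>A. u x * v x) = 0" by (intro sum.neutral) blast
    then show ?thesis by simp
  next
    case False
    with UV have pos: "U > 0" "V > 0" by auto
    have "(\<Sum>x\<in>A. (u x / U powr (1 / p)) * (v x / V powr (1 / q)))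
        \<le> (\<Sum>x\<in>A. (u x / U powr (1 / p)) powr p / p + (v x / V powr (1 / q)) powr q / q)"
      using assms by (intro sum_mono Youngs_inequality) auto
    also have "\<dots> = (\<Sum>x\<in>A. u x powr p / U / p + v x powr q / V / q)"
      using pos assms(2,3) nonneg by (intro sum.cong) (auto simp: powr_divide powr_powr)
    also have "\<dots> = 1 / p + 1 / q"
      using pos by (simp add: sum.distrib flip: sum_divide_distrib U_def V_def)
    finally have "(\<Sum>x\<in>A. u x * v x) / (U powr (1 / p) * V powr (1 / q)) \<le> 1"
      using assms(4) by (simp add: sum_divide_distrib)
    moreover have "U powr (1 / p) * V powr (1 / q) > 0" using pos by simp
    ultimately show ?thesis by (simp only: pos_divide_le_eq mult_1 U_def[symmetric] V_def[symmetric])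
  qed
qed

lemma lp_norm_nonneg [simp]: "lp_norm N p f \<ge> 0"
  by (simp add: lp_norm_def)

lemma lp_norm_pos:
  assumes "\<exists>x\<in>ZN N. f x \<noteq> 0"
  shows "lp_norm N p f > 0"
proof -
  have "(\<Sum>x\<in>ZN N. cmod (f x) powr p) > 0"
    using assms by (auto intro!: sum_pos2)
  then show ?thesis by (simp add: lp_norm_def)
qed

text \<open>Since \<open>q = (2 - q) * 1 + (q - 1) * 2\<close>, weighted AM-GM with weights
  \<open>2 - q\<close> and \<open>q - 1\<close> applies pointwise to \<open>cmod (f x) / A\<close>
  and \<open>(cmod (f x))\<^sup>2 / B\<^sup>2\<close>. Both of these sum to 1, and so do the
  weights.\<close>

lemma lp_norm_interpolation:
  assumes "\<exists>x\<in>ZN N. f x \<noteq> 0" "1 \<le> q" "q \<le> 2"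
  shows "lp_norm N q f \<le> lp_norm N 1 f powr (2 / q - 1) * lp_norm N 2 f powr (2 - 2 / q)"
proof -
  define A B where "A = lp_norm N 1 f" and "B = lp_norm N 2 f"
  have pos: "A > 0" "B > 0" using lp_norm_pos[OF assms(1)] by (auto simp: A_def B_def)
  have A: "A = (\<Sum>x\<in>ZN N. cmod (f x))"
    by (simp add: A_def lp_norm_def sum_nonneg)
  have "B\<^sup>2 = B powr 2" using pos by simp
  also have "\<dots> = (\<Sum>x\<in>ZN N. (cmod (f x))\<^sup>2)"
    unfolding B_def lp_norm_def by (simp add: powr_powr sum_nonneg)
  finally have B: "B\<^sup>2 = (\<Sum>x\<in>ZN N. (cmod (f x))\<^sup>2)" .
  have "(\<Sum>x\<in>ZN N. cmod (f x) powr q) / (A powr (2 - q) * (B\<^sup>2) powr (q - 1))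
      = (\<Sum>x\<in>ZN N. cmod (f x) powr q / (A powr (2 - q) * (B\<^sup>2) powr (q - 1)))"
    by (rule sum_divide_distrib)
  also have "\<dots> \<le> (\<Sum>x\<in>ZN N. (2 - q) * (cmod (f x) / A) + (q - 1) * ((cmod (f x))\<^sup>2 / B\<^sup>2))"
  proof (rule sum_mono)
    fix x
    show "cmod (f x) powr q / (A powr (2 - q) * (B\<^sup>2) powr (q - 1))
        \<le> (2 - q) * (cmod (f x) / A) + (q - 1) * ((cmod (f x))\<^sup>2 / B\<^sup>2)"
    proof (cases "f x = 0")
      case False
      then have y: "cmod (f x) > 0" by simp
      have "(cmod (f x))\<^sup>2 powr (q - 1) = cmod (f x) powr (2 * (q - 1))"
        using y by (simp add: powr_powr flip: powr_numeral)
      then have "cmod (f x) powr (2 - q) * (cmod (f x))\<^sup>2 powr (q - 1) = cmod (f x) powr q"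
        by (simp add: powr_add[symmetric])
      then have "cmod (f x) powr q / (A powr (2 - q) * (B\<^sup>2) powr (q - 1))
          = (cmod (f x) / A) powr (2 - q) * ((cmod (f x))\<^sup>2 / B\<^sup>2) powr (q - 1)"
        using pos by (simp add: powr_divide)
      also have "\<dots> \<le> (2 - q) * (cmod (f x) / A) + (q - 1) * ((cmod (f x))\<^sup>2 / B\<^sup>2)"
        using assms(2,3) pos y by (intro Youngs_inequality_0) auto
      finally show ?thesis .
    qed simp
  qed
  also have "\<dots> = (2 - q) * (A / A) + (q - 1) * (B\<^sup>2 / B\<^sup>2)"
    by (simp only: sum.distrib sum_distrib_left[symmetric] sum_divide_distrib[symmetric]
        A[symmetric] B[symmetric])
  also have "\<dots> = 1" using pos by simp
  finally have "(\<Sum>x\<in>ZN N. cmod (f x) powr q) \<le> A powr (2 - q) * (B\<^sup>2) powr (q - 1)"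
    using pos by (simp add: pos_divide_le_eq)
  then have "lp_norm N q f \<le> (A powr (2 - q) * (B\<^sup>2) powr (q - 1)) powr (1 / q)"
    unfolding lp_norm_def using assms(2) by (intro powr_mono2) (auto intro: sum_nonneg)
  also have "\<dots> = A powr ((2 - q) / q) * B powr (2 * (q - 1) / q)"
    using pos by (simp add: powr_mult powr_powr flip: powr_numeral)
  also have "(2 - q) / q = 2 / q - 1" using assms(2) by (simp add: field_simps)
  also have "2 * (q - 1) / q = 2 - 2 / q" using assms(2) by (simp add: field_simps)
  finally show ?thesis by (simp add: A_def B_def)
qed

section \<open>The size of a dissociated part of the spectrum\<close>

text \<open>Duality: \<open>S\<close> is, up to the factor \<open>sqrt (real N)\<close>, the pairing
  of \<open>f\<close> with a polynomial \<open>T\<close> whose coefficients have squared norm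
  \<open>S\<close> again. Hoelder and Rudin give \<open>S \<le> D * sqrt S\<close>, and one factor
  \<open>sqrt S\<close> cancels.\<close>

lemma sum_fourier_dissociated_le:
  fixes p :: real
  assumes "N > 0" "finite \<Lambda>" "dissociated N \<Lambda>" "p > 1"
  shows "(\<Sum>l\<in>\<Lambda>. (cmod (fourier N f l))\<^sup>2)
           \<le> 16 * p * real N powr (2 / p) / real N * (lp_norm N (p / (p - 1)) f)\<^sup>2"
proof -
  define q where "q = p / (p - 1)"
  have q: "q > 1" "1 / q + 1 / p = 1" using assms(4) by (auto simp: q_def field_simps)
  define S where "S = (\<Sum>l\<in>\<Lambda>. (cmod (fourier N f l))\<^sup>2)"
  have S: "S \<ge> 0" by (simp add: S_def sum_nonneg)
  \<comment> \<open>Only the coefficients are conjugated; the kernel is that of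
    \<open>fourier\<close>, so the pairing with \<open>f\<close> needs no further conjugate.\<close>
  define T where "T x = (\<Sum>l\<in>\<Lambda>. cnj (fourier N f l) * char_exp N (x * l))" for x
  define K where "K = 2 * real N powr (1 / p) * sqrt p * sqrt S"
  have "complex_of_real S = (\<Sum>l\<in>\<Lambda>. cnj (fourier N f l) * fourier N f l)"
    unfolding S_def by (simp add: complex_norm_square mult.commute del: of_real_power)
  also have "\<dots> = (\<Sum>l\<in>\<Lambda>. \<Sum>x\<in>ZN N. cnj (fourier N f l) * char_exp N (x * l) * f x / of_real (sqrt (real N)))"
    by (subst (2) fourier_def)
       (simp add: char_exp_def sum_distrib_left sum_divide_distrib mult.assoc)
  also have "\<dots> = (\<Sum>x\<in>ZN N. T x * f x) / of_real (sqrt (real N))"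
    by (subst sum.swap) (simp add: T_def sum_distrib_right sum_divide_distrib)
  finally have "cmod (complex_of_real S) = cmod ((\<Sum>x\<in>ZN N. T x * f x) / of_real (sqrt (real N)))"
    by simp
  then have "S = cmod (\<Sum>x\<in>ZN N. T x * f x) / sqrt (real N)"
    using S by (simp add: norm_divide)
  also have "cmod (\<Sum>x\<in>ZN N. T x * f x) \<le> (\<Sum>x\<in>ZN N. cmod (f x) * \<bar>Re (T x)\<bar>)
      + (\<Sum>x\<in>ZN N. cmod (f x) * \<bar>Im (T x)\<bar>)"
  proof -
    have "cmod (\<Sum>x\<in>ZN N. T x * f x) \<le> (\<Sum>x\<in>ZN N. cmod (f x) * (\<bar>Re (T x)\<bar> + \<bar>Im (T x)\<bar>))"
    proof (rule sum_norm_le)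
      fix x
      show "cmod (T x * f x) \<le> cmod (f x) * (\<bar>Re (T x)\<bar> + \<bar>Im (T x)\<bar>)"
        using mult_left_mono[OF cmod_le[of "T x"], of "cmod (f x)"]
        by (simp add: norm_mult mult.commute)
    qed
    then show ?thesis by (simp add: ring_distribs sum.distrib)
  qed
  also have "(\<Sum>x\<in>ZN N. cmod (f x) * \<bar>Re (T x)\<bar>) \<le> lp_norm N q f * K"
  proof -
    have "(\<Sum>x\<in>ZN N. cmod (f x) * \<bar>Re (T x)\<bar>)
        \<le> lp_norm N q f * (\<Sum>x\<in>ZN N. \<bar>Re (T x)\<bar> powr p) powr (1 / p)"
      unfolding lp_norm_def using q assms(4) by (intro holder_inequality_sum) auto
    also have "\<dots> \<le> lp_norm N q f * K"
      using rudin_Re[OF assms(1-3), of p "\<lambda>l. cnj (fourier N f l)"] assms(4)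
      by (intro mult_left_mono) (auto simp: T_def K_def S_def)
    finally show ?thesis .
  qed
  also have "(\<Sum>x\<in>ZN N. cmod (f x) * \<bar>Im (T x)\<bar>) \<le> lp_norm N q f * K"
  proof -
    have "(\<Sum>x\<in>ZN N. cmod (f x) * \<bar>Im (T x)\<bar>)
        \<le> lp_norm N q f * (\<Sum>x\<in>ZN N. \<bar>Im (T x)\<bar> powr p) powr (1 / p)"
      unfolding lp_norm_def using q assms(4) by (intro holder_inequality_sum) auto
    also have "\<dots> \<le> lp_norm N q f * K"
      using rudin_Im[OF assms(1-3), of p "\<lambda>l. cnj (fourier N f l)"] assms(4)
      by (intro mult_left_mono) (auto simp: T_def K_def S_def)
    finally show ?thesis .
  qed
  finally have main: "S \<le> (lp_norm N q f * K + lp_norm N q f * K) / sqrt (real N)"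
    by (simp add: divide_right_mono)
  \<comment> \<open>The 4 is Rudin's constant 2, once for the real and once for the imaginary part;
    its square is the 16 of the final bound.\<close>
  define D where "D = 4 * real N powr (1 / p) * sqrt p * lp_norm N q f / sqrt (real N)"
  have "D \<ge> 0" using assms(4) by (simp add: D_def)
  have "sqrt S * sqrt S \<le> D * sqrt S"
    using main S by (simp add: D_def K_def mult_ac)
  then have "sqrt S \<le> D"
  proof (cases "S = 0")
    case False
    with S have "sqrt S > 0" by simp
    with \<open>sqrt S * sqrt S \<le> D * sqrt S\<close> show ?thesis by (rule mult_right_le_imp_le)
  qed (use \<open>D \<ge> 0\<close> in simp)
  then have "S \<le> D\<^sup>2" using S by (simp add: real_le_lsqrt sqrt_le_D)
  also have "D\<^sup>2 = 16 * p * real N powr (2 / p) / real N * (lp_norm N q f)\<^sup>2"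
  proof -
    have "(real N powr (1 / p))\<^sup>2 = real N powr (2 / p)"
      by (simp add: powr_add[symmetric] power2_eq_square)
    then show ?thesis using assms(1,4) by (simp add: D_def power_mult_distrib power_divide)
  qed
  finally show ?thesis by (simp add: S_def q_def)
qed

text \<open>Every \<open>l \<in> \<Lambda>\<close> contributes at least
  \<open>(\<eta> * L2mu_norm N f)\<^sup>2\<close> to the sum just bounded, and the normalisation of
  \<open>L2mu_norm\<close> cancels the factor \<open>1 / real N\<close>.\<close>

lemma card_dissociated_le:
  fixes p :: real
  assumes "N > 0" "\<exists>x\<in>ZN N. f x \<noteq> 0" "\<eta> > 0" "p > 1"
    and "dissociated N \<Lambda>" "\<Lambda> \<subseteq> large_spectrum N f \<eta>"
  shows "real (card \<Lambda>)
           \<le> 16 * p * real N powr (2 / p) / \<eta>\<^sup>2 * (lp_norm N (p / (p - 1)) f / lp_norm N 2 f)\<^sup>2"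
proof -
  have fin: "finite \<Lambda>"
    using assms(6) by (rule finite_subset) (simp add: large_spectrum_def)
  have B: "lp_norm N 2 f > 0" using assms(2) by (rule lp_norm_pos)
  have "real (card \<Lambda>) * (\<eta> * L2mu_norm N f)\<^sup>2 = (\<Sum>l\<in>\<Lambda>. (\<eta> * L2mu_norm N f)\<^sup>2)" by simp
  also have "\<dots> \<le> (\<Sum>l\<in>\<Lambda>. (cmod (fourier N f l))\<^sup>2)"
    using assms(3,6)
    by (intro sum_mono power_mono) (auto simp: large_spectrum_def L2mu_norm_def)
  also have "\<dots> \<le> 16 * p * real N powr (2 / p) / real N * (lp_norm N (p / (p - 1)) f)\<^sup>2"
    using assms fin by (intro sum_fourier_dissociated_le) auto
  finally have "real (card \<Lambda>) * (\<eta>\<^sup>2 * (lp_norm N 2 f)\<^sup>2) / real N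
      \<le> 16 * p * real N powr (2 / p) * (lp_norm N (p / (p - 1)) f)\<^sup>2 / real N"
    by (simp add: L2mu_norm_def power_mult_distrib power_divide)
  then have "real (card \<Lambda>) * (\<eta>\<^sup>2 * (lp_norm N 2 f)\<^sup>2)
      \<le> 16 * p * real N powr (2 / p) * (lp_norm N (p / (p - 1)) f)\<^sup>2"
    using assms(1) by (simp add: divide_le_cancel)
  then show ?thesis using B assms(3) by (simp add: power_divide field_simps)
qed

section \<open>The two choices of the exponent\<close>

lemma powr_two_div_ln:
  fixes x :: real
  assumes "x > 1"
  shows "x powr (2 / ln x) = exp 2"
  using assms by (simp add: powr_def)

lemma ln_gt_1:
  fixes x :: real
  assumes "x \<ge> 3"
  shows "ln x > 1"
proof -
  \<comment> \<open>At 1 the quadratic bound yields only \<open>exp 1 \<le> 3\<close>, which is not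
    strict; at 1/4 the fourth power of 21/16 is about 2.97.\<close>
  have "exp (1 / 4 :: real) \<le> 21 / 16" using exp_bound[of "1 / 4 :: real"] by (simp add: power2_eq_square)
  then have "exp (1 / 4 :: real) ^ 4 \<le> (21 / 16) ^ 4" by (intro power_mono) auto
  also have "\<dots> < (3 :: real)" by (simp add: power_divide)
  also have "exp (1 / 4 :: real) ^ 4 = exp 1" by (simp flip: exp_of_nat_mult)
  finally have "exp 1 < x" using assms by simp
  then have "ln (exp 1) < ln x" using assms by (subst ln_less_cancel_iff) auto
  then show ?thesis by simp
qed

text \<open>With \<open>p = ln (real N)\<close> the loss \<open>real N powr (2 / p)\<close> is the
  constant \<open>exp 2\<close>; \<open>N \<ge> 3\<close> ensures \<open>p > 1\<close>.\<close>

lemma card_dissociated_le_ln_N: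
  assumes "N \<ge> 3" "\<exists>x\<in>ZN N. f x \<noteq> 0" "\<eta> > 0"
    and "dissociated N \<Lambda>" "\<Lambda> \<subseteq> large_spectrum N f \<eta>"
  shows "real (card \<Lambda>) \<le> 16 * exp 2 / \<eta>\<^sup>2
           * (lp_norm N (ln (real N) / (ln (real N) - 1)) f / lp_norm N 2 f)\<^sup>2 * ln (real N)"
proof -
  have "ln (real N) > 1" using assms(1) by (intro ln_gt_1) simp
  with card_dissociated_le[of N f \<eta> "ln (real N)" \<Lambda>] assms show ?thesis
    by (simp add: powr_two_div_ln mult_ac)
qed

text \<open>Interpolation turns \<open>real N powr (2 / p)\<close> times the squared norm ratio into
  \<open>(A / B)\<^sup>2 * R powr (2 / p)\<close>, so the power of \<open>R\<close> is the loss to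
  be controlled, and \<open>p = ln R\<close> makes it \<open>exp 2\<close>.\<close>

lemma card_dissociated_le_ln_ratio:
  assumes "N > 0" "\<exists>x\<in>ZN N. f x \<noteq> 0" "\<eta> > 0"
    and "dissociated N \<Lambda>" "\<Lambda> \<subseteq> large_spectrum N f \<eta>"
    and ratio: "lp_norm N 1 f / lp_norm N 2 f \<le> 1 / exp 1 * sqrt (real N)"
  shows "real (card \<Lambda>) \<le> 16 * exp 2 / \<eta>\<^sup>2
           * ((lp_norm N 1 f)\<^sup>2 / (lp_norm N 2 f)\<^sup>2)
           * ln ((lp_norm N 2 f / lp_norm N 1 f)\<^sup>2 * real N)"
proof -
  define A B where "A = lp_norm N 1 f" and "B = lp_norm N 2 f"
  have pos: "A > 0" "B > 0" using lp_norm_pos[OF assms(2)] by (auto simp: A_def B_def)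
  define R where "R = (B / A)\<^sup>2 * real N"
  define p where "p = ln R"
  define q where "q = p / (p - 1)"
  have "exp 1 \<le> B / A * sqrt (real N)"
    using ratio pos unfolding A_def[symmetric] B_def[symmetric] by (simp add: field_simps)
  then have "(exp 1)\<^sup>2 \<le> (B / A * sqrt (real N))\<^sup>2" by (intro power_mono) auto
  then have R: "exp 2 \<le> R"
    by (simp add: R_def power_mult_distrib power_divide flip: exp_of_nat_mult)
  have "R > 0" using R by (meson exp_gt_zero less_le_trans)
  \<comment> \<open>This is what the hypothesis on the ratio provides: \<open>p \<ge> 2\<close>
    places the conjugate \<open>q\<close> in the interpolation range up to 2.\<close>
  then have p: "p \<ge> 2" using R by (simp add: p_def ln_ge_iff)
  have "R > 1" using R by (meson exp_gt_one less_le_trans zero_less_numeral)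
  have q: "1 \<le> q" "q \<le> 2" "1 / q = 1 - 1 / p" using p by (auto simp: q_def field_simps)
  have "real N powr (2 / p) * (lp_norm N q f / B)\<^sup>2 \<le> (A / B)\<^sup>2 * R powr (2 / p)"
  proof -
    have "lp_norm N q f \<le> A powr (2 / q - 1) * B powr (2 - 2 / q)"
      unfolding A_def B_def using assms(2) q by (intro lp_norm_interpolation) auto
    also have "2 / q - 1 = 1 - 2 / p" using q(3) by (simp add: field_simps)
    also have "2 - 2 / q = 2 / p" using q(3) by (simp add: field_simps)
    also have "A powr (1 - 2 / p) * B powr (2 / p) = A * (B / A) powr (2 / p)"
      using pos by (simp add: powr_diff powr_divide)
    finally have "(lp_norm N q f / B)\<^sup>2 \<le> (A / B * (B / A) powr (2 / p))\<^sup>2"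
      using pos by (intro power_mono) (auto simp: divide_right_mono)
    also have "\<dots> = (A / B)\<^sup>2 * ((B / A)\<^sup>2) powr (2 / p)"
    proof -
      have "((B / A) powr (2 / p))\<^sup>2 = ((B / A)\<^sup>2) powr (2 / p)"
        using pos by (simp only: powr_mult power2_eq_square)
      then show ?thesis by (simp only: power_mult_distrib)
    qed
    finally have "real N powr (2 / p) * (lp_norm N q f / B)\<^sup>2
        \<le> real N powr (2 / p) * ((A / B)\<^sup>2 * ((B / A)\<^sup>2) powr (2 / p))"
      by (intro mult_left_mono) auto
    then show ?thesis by (simp add: R_def powr_mult mult_ac)
  qed
  also have "R powr (2 / p) = exp 2" using \<open>R > 1\<close> by (simp add: p_def powr_two_div_ln)
  finally have *: "real N powr (2 / p) * (lp_norm N q f / B)\<^sup>2 \<le> (A / B)\<^sup>2 * exp 2" .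
  have "real (card \<Lambda>) \<le> 16 * p * real N powr (2 / p) / \<eta>\<^sup>2 * (lp_norm N q f / B)\<^sup>2"
    unfolding q_def B_def using assms p by (intro card_dissociated_le) auto
  also have "\<dots> = 16 * p / \<eta>\<^sup>2 * (real N powr (2 / p) * (lp_norm N q f / B)\<^sup>2)" by simp
  also have "\<dots> \<le> 16 * p / \<eta>\<^sup>2 * ((A / B)\<^sup>2 * exp 2)"
    using * p by (intro mult_left_mono) auto
  finally show ?thesis
    by (simp add: p_def R_def A_def B_def power_divide mult_ac)
qed

theorem theorem1p40:
  "\<exists>C::real. \<forall>(N::nat) (f :: int \<Rightarrow> complex) (\<eta>::real).
     N \<ge> 3 \<longrightarrow> (\<exists>x\<in>ZN N. f x \<noteq> 0) \<longrightarrow> \<eta> > 0 \<longrightarrow>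
     (\<exists>\<Lambda> \<subseteq> large_spectrum N f \<eta>.
        (\<forall>m\<in>large_spectrum N f \<eta>. signed_combination N \<Lambda> m) \<and>
        real (card \<Lambda>) \<le> C / \<eta>\<^sup>2
          * (lp_norm N (ln (real N) / (ln (real N) - 1)) f / lp_norm N 2 f)\<^sup>2 * ln (real N) \<and>
        (lp_norm N 1 f / lp_norm N 2 f \<le> 1 / exp 1 * sqrt (real N) \<longrightarrow>
           real (card \<Lambda>) \<le> C / \<eta>\<^sup>2
             * ((lp_norm N 1 f)\<^sup>2 / (lp_norm N 2 f)\<^sup>2)
             * ln ((lp_norm N 2 f / lp_norm N 1 f)\<^sup>2 * real N)))"
proof (rule exI[of _ "16 * exp 2"], intro allI impI)
  fix N :: nat and f :: "int \<Rightarrow> complex" and \<eta> :: real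
  assume N: "N \<ge> 3" and f: "\<exists>x\<in>ZN N. f x \<noteq> 0" and \<eta>: "\<eta> > 0"
  have "finite (large_spectrum N f \<eta>)" by (simp add: large_spectrum_def)
  \<comment> \<open>The set is fixed before any exponent is chosen, so one \<open>\<Lambda>\<close>
    satisfies both bounds.\<close>
  then obtain \<Lambda> where \<Lambda>: "\<Lambda> \<subseteq> large_spectrum N f \<eta>" "dissociated N \<Lambda>"
    "\<forall>m\<in>large_spectrum N f \<eta>. signed_combination N \<Lambda> m"
    using exists_dissociated_spanning_subset by blast
  have "N > 0" using N by simp
  show "\<exists>\<Lambda> \<subseteq> large_spectrum N f \<eta>.
        (\<forall>m\<in>large_spectrum N f \<eta>. signed_combination N \<Lambda> m) \<and>
        real (card \<Lambda>) \<le> 16 * exp 2 / \<eta>\<^sup>2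
          * (lp_norm N (ln (real N) / (ln (real N) - 1)) f / lp_norm N 2 f)\<^sup>2 * ln (real N) \<and>
        (lp_norm N 1 f / lp_norm N 2 f \<le> 1 / exp 1 * sqrt (real N) \<longrightarrow>
           real (card \<Lambda>) \<le> 16 * exp 2 / \<eta>\<^sup>2
             * ((lp_norm N 1 f)\<^sup>2 / (lp_norm N 2 f)\<^sup>2)
             * ln ((lp_norm N 2 f / lp_norm N 1 f)\<^sup>2 * real N))"
    using \<Lambda> card_dissociated_le_ln_N[OF N f \<eta> \<Lambda>(2,1)]
      card_dissociated_le_ln_ratio[OF \<open>N > 0\<close> f \<eta> \<Lambda>(2,1)]
    by (intro exI[of _ \<Lambda>] conjI impI)
qed

end
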